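(* Let $n \geq 2$ and $A = \{0,1,\ldots,n-1\}$. Every normal amenable subgroup of $\operatorname{Aut}(A^{\mathbb{Z}})$ is contained in $\Sigma(A^{\mathbb{Z}})$.
   Context: $A^{\mathbb{Z}}$ carries the product topology of the discrete finite set $A$. The map $\sigma \colon A^{\mathbb{Z}} \to A^{\mathbb{Z}}$ is the left shift, $(\sigma x)_m = x_{m+1}$. $\operatorname{Aut}(A^{\mathbb{Z}})$ is the group (under composition) of all homeomorphisms of $A^{\mathbb{Z}}$ that commute with $\sigma$. $\Sigma(A^{\mathbb{Z}}) = \{\sigma^k : k \in \mathbb{Z}\}$ is the subgroup consisting of the powers of the shift. Amenability is that of discrete groups. *)

theory Defs
  imports "HOL-Analysis.Analysis" "HOL-Algebra.Bij" "HOL-Algebra.Coset"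
begin

definition full_shift :: "nat \<Rightarrow> (int \<Rightarrow> nat) topology"
  where "full_shift n = product_topology (\<lambda>_. discrete_topology {0..<n}) UNIV"

(* As in HOL-Algebra.Bij, self-maps of the space are represented by functions that are
   undefined outside of it, so that equality of group elements is equality of maps. *)
definition shift :: "nat \<Rightarrow> (int \<Rightarrow> nat) \<Rightarrow> (int \<Rightarrow> nat)"
  where "shift n = (\<lambda>x \<in> topspace (full_shift n). \<lambda>m. x (m + 1))"

definition shift_Aut :: "nat \<Rightarrow> ((int \<Rightarrow> nat) \<Rightarrow> (int \<Rightarrow> nat)) monoid"
  where "shift_Aut n =
    (BijGroup (topspace (full_shift n)))
      \<lparr>carrier := {f \<in> Bij (topspace (full_shift n)).
                    homeomorphic_map (full_shift n) (full_shift n) f \<and>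
                    (\<forall>x \<in> topspace (full_shift n). f (shift n x) = shift n (f x))}\<rparr>"

definition shift_powers :: "nat \<Rightarrow> ((int \<Rightarrow> nat) \<Rightarrow> (int \<Rightarrow> nat)) set"
  where "shift_powers n = {shift n [^]\<^bsub>shift_Aut n\<^esub> k | k :: int. True}"

(* Amenability of a discrete group: there is a finitely additive, left-invariant
   probability measure defined on all subsets of the group. *)
definition amenable :: "('a, 'b) monoid_scheme \<Rightarrow> bool"
  where "amenable G \<longleftrightarrow> group G \<and>
    (\<exists>\<mu> :: 'a set \<Rightarrow> real.
      (\<forall>S. S \<subseteq> carrier G \<longrightarrow> 0 \<le> \<mu> S) \<and>
      \<mu> (carrier G) = 1 \<and>
      (\<forall>S T. S \<subseteq> carrier G \<longrightarrow> T \<subseteq> carrier G \<longrightarrow> S \<inter> T = {} \<longrightarrow> \<mu> (S \<union> T) = \<mu> S + \<mu> T) \<and>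
      (\<forall>g S. g \<in> carrier G \<longrightarrow> S \<subseteq> carrier G \<longrightarrow> \<mu> (g <#\<^bsub>G\<^esub> S) = \<mu> S))"

lemma topspace_full_shift: "topspace (full_shift n) = {x. \<forall>m. x m < n}"
  by (auto simp: full_shift_def PiE_def Pi_def)

lemma subgroup_shift_Aut:
  "subgroup (carrier (shift_Aut n)) (BijGroup (topspace (full_shift n)))"
proof -
  let ?X = "full_shift n"
  let ?S = "topspace ?X"
  interpret B: group "BijGroup ?S" by (rule group_BijGroup)
  have shS: "shift n x \<in> ?S" if "x \<in> ?S" for x
    using that by (simp add: shift_def topspace_full_shift)
  show ?thesis
  proof (rule B.subgroupI)
    show "carrier (shift_Aut n) \<subseteq> carrier (BijGroup ?S)"
      by (auto simp: shift_Aut_def BijGroup_def)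
    have "homeomorphic_map ?X ?X (\<lambda>x\<in>?S. x)"
      by (rule homeomorphic_map_eq[of _ _ id]) auto
    then have "(\<lambda>x\<in>?S. x) \<in> carrier (shift_Aut n)"
      using shS by (simp add: shift_Aut_def id_Bij)
    then show "carrier (shift_Aut n) \<noteq> {}" by blast
  next
    fix f assume f: "f \<in> carrier (shift_Aut n)"
    then have fB: "f \<in> Bij ?S" and fh: "homeomorphic_map ?X ?X f"
      and fc: "\<And>x. x \<in> ?S \<Longrightarrow> f (shift n x) = shift n (f x)"
      by (auto simp: shift_Aut_def)
    have bij: "bij_betw f ?S ?S" using fB by (simp add: Bij_def)
    let ?g = "\<lambda>x\<in>?S. inv_into ?S f x"
    have gB: "?g \<in> Bij ?S" by (rule restrict_inv_into_Bij[OF fB])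
    have gf: "compose ?S ?g f = (\<lambda>x\<in>?S. x)"
      by (rule Bij_compose_restrict_eq[OF fB])
    have inv: "inv\<^bsub>BijGroup ?S\<^esub> f = ?g"
      by (rule B.inv_equality) (use fB gB gf in \<open>auto simp: BijGroup_def\<close>)
    have gS: "inv_into ?S f y \<in> ?S" "f (inv_into ?S f y) = y" if "y \<in> ?S" for y
      using Bij_inv_into_mem[OF fB that] bij_betw_inv_into_right[OF bij that] by auto
    obtain h where h: "homeomorphic_maps ?X ?X f h"
      using fh homeomorphic_map_maps by blast
    have "homeomorphic_map ?X ?X ?g"
    proof (rule homeomorphic_map_eq[of _ _ h])
      show "homeomorphic_map ?X ?X h" using h homeomorphic_maps_map by blast
      fix y assume y: "y \<in> ?S"
      then have "h (f (inv_into ?S f y)) = inv_into ?S f y"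
        using h gS(1)[OF y] by (simp add: homeomorphic_maps_def)
      then show "h y = ?g y" using y gS(2)[OF y] by simp
    qed
    moreover have "?g (shift n y) = shift n (?g y)" if y: "y \<in> ?S" for y
    proof -
      have "f (shift n (inv_into ?S f y)) = shift n y"
        using fc[OF gS(1)[OF y]] gS(2)[OF y] by simp
      then have "inv_into ?S f (shift n y) = shift n (inv_into ?S f y)"
        using bij_betw_inv_into_left[OF bij shS[OF gS(1)[OF y]]] by simp
      then show ?thesis using y shS[OF y] by simp
    qed
    ultimately show "inv\<^bsub>BijGroup ?S\<^esub> f \<in> carrier (shift_Aut n)"
      using gB unfolding inv by (simp add: shift_Aut_def)
  next
    fix f g assume fg: "f \<in> carrier (shift_Aut n)" "g \<in> carrier (shift_Aut n)"
    then have B: "f \<in> Bij ?S" "g \<in> Bij ?S"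
      and h: "homeomorphic_map ?X ?X f" "homeomorphic_map ?X ?X g"
      and c: "\<And>x. x \<in> ?S \<Longrightarrow> f (shift n x) = shift n (f x)"
             "\<And>x. x \<in> ?S \<Longrightarrow> g (shift n x) = shift n (g x)"
      by (auto simp: shift_Aut_def)
    have gS: "g x \<in> ?S" if "x \<in> ?S" for x
      using Bij_imp_funcset[OF B(2)] that by auto
    have "homeomorphic_map ?X ?X (compose ?S f g)"
      by (rule homeomorphic_map_eq[OF homeomorphic_map_compose[OF h(2) h(1)]])
        (simp add: compose_def)
    then show "f \<otimes>\<^bsub>BijGroup ?S\<^esub> g \<in> carrier (shift_Aut n)"
      using B c shS gS compose_Bij[OF B]
      by (simp add: shift_Aut_def BijGroup_def compose_eq)
  qed
qed

lemma group_shift_Aut: "group (shift_Aut n)"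
proof -
  have "shift_Aut n = (BijGroup (topspace (full_shift n)))\<lparr>carrier := carrier (shift_Aut n)\<rparr>"
    by (simp add: shift_Aut_def)
  then show ?thesis
    using subgroup.subgroup_is_group[OF subgroup_shift_Aut group_BijGroup] by metis
qed

lemma shift_translate_in_Aut:
  "(\<lambda>x \<in> topspace (full_shift n). \<lambda>m. x (m + k)) \<in> carrier (shift_Aut n)"
proof -
  let ?X = "full_shift n"
  let ?S = "topspace ?X"
  have cont: "continuous_map ?X ?X (\<lambda>x m. x (m + j))" for j :: int
    unfolding full_shift_def continuous_map_componentwise_UNIV
    by (intro allI continuous_map_product_projection) simp
  have "homeomorphic_maps ?X ?X (\<lambda>x m. x (m + k)) (\<lambda>x m. x (m + - k))"
    unfolding homeomorphic_maps_def using cont[of k] cont[of "- k"] by simp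
  then have "homeomorphic_map ?X ?X (\<lambda>x m. x (m + k))"
    using homeomorphic_map_maps by blast
  then have h: "homeomorphic_map ?X ?X (\<lambda>x\<in>?S. \<lambda>m. x (m + k))"
    by (rule homeomorphic_map_eq) simp
  then have "(\<lambda>x\<in>?S. \<lambda>m. x (m + k)) \<in> Bij ?S"
    unfolding Bij_def bij_betw_def homeomorphic_eq_everything_map by auto
  with h show ?thesis
    by (auto simp: shift_Aut_def shift_def topspace_full_shift algebra_simps)
qed

lemma shift_int_pow:
  "shift n [^]\<^bsub>shift_Aut n\<^esub> (k :: int) = (\<lambda>x \<in> topspace (full_shift n). \<lambda>m. x (m + k))"
proof -
  let ?t = "\<lambda>k :: int. \<lambda>x \<in> topspace (full_shift n). \<lambda>m. x (m + k)"
  interpret G: group "shift_Aut n" by (rule group_shift_Aut)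
  have tB: "?t j \<in> Bij (topspace (full_shift n))" for j
    using shift_translate_in_Aut[where n=n and k=j] by (simp add: shift_Aut_def)
  have mult: "?t i \<otimes>\<^bsub>shift_Aut n\<^esub> ?t j = ?t (i + j)" for i j
  proof -
    have "?t i \<otimes>\<^bsub>shift_Aut n\<^esub> ?t j = compose (topspace (full_shift n)) (?t i) (?t j)"
      using tB[of i] tB[of j] by (simp add: shift_Aut_def BijGroup_def)
    also have "\<dots> = ?t (i + j)"
      by (rule ext) (auto simp: compose_def topspace_full_shift algebra_simps)
    finally show ?thesis .
  qed
  have one: "\<one>\<^bsub>shift_Aut n\<^esub> = ?t 0"
    by (simp add: shift_Aut_def BijGroup_def)
  have sh: "shift n = ?t 1" by (simp add: shift_def)
  have nat: "shift n [^]\<^bsub>shift_Aut n\<^esub> (i :: nat) = ?t (int i)" for i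
  proof (induction i)
    case 0 then show ?case by (simp add: one)
  next
    case (Suc i)
    have "shift n [^]\<^bsub>shift_Aut n\<^esub> Suc i = ?t (int i) \<otimes>\<^bsub>shift_Aut n\<^esub> ?t 1"
      unfolding G.nat_pow_Suc Suc.IH by (simp only: sh)
    also have "\<dots> = ?t (int (Suc i))"
      unfolding mult by (simp add: add.commute)
    finally show ?case .
  qed
  have inv: "inv\<^bsub>shift_Aut n\<^esub> (?t i) = ?t (- i)" for i
  proof (rule G.inv_equality)
    show "?t (- i) \<otimes>\<^bsub>shift_Aut n\<^esub> ?t i = \<one>\<^bsub>shift_Aut n\<^esub>"
      unfolding mult one by simp
  qed (rule shift_translate_in_Aut)+
  show ?thesis
  proof (cases "k < 0")
    case True
    then show ?thesis unfolding int_pow_def2 nat inv by simp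
  next
    case False
    then show ?thesis unfolding int_pow_def2 nat by simp
  qed
qed

end

theory Submission
  imports Defs
begin

text \<open>
Write \<open>0\<close> for the constant configuration with value 0 and let \<open>X\<close> be the set of configurations that have a first
nonzero coordinate. Automorphisms that fix \<open>0\<close> act on \<open>X\<close>, and the shift is invisible for sets that
are invariant under translation. Such sets are the cones \<open>U(u, K)\<close>: the configurations whose nonzero
part begins with the first \<open>K\<close> symbols of a given pattern \<open>u\<close> with \<open>u 0 \<noteq> 0\<close>.

The action on \<open>X\<close> is extremely contracting. For \<open>l \<ge> K\<close> there is an involution, \<open>toggle u K l\<close>, in the
automorphism group that exchanges \<open>...000y\<close> and \<open>...000vy\<close>, where \<open>v\<close> consists of the first \<open>l\<close>
symbols of \<open>u\<close> and \<open>y\<close> begins with a nonzero symbol but not with the first \<open>K\<close> symbols of \<open>u\<close>.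
Let \<open>V(u, l)\<close> be the set of configurations whose nonzero part begins with \<open>v\<close> and then a nonzero symbol.
Since \<open>...000vy\<close> lies in \<open>U(u, K)\<close>, the involution maps all of \<open>X\<close> outside of
\<open>V(u, l)\<close> into \<open>U(u, K)\<close> (\<open>toggle_maps_into_cone\<close>). If \<open>u\<close> vanishes from \<open>K\<close> on, the sets \<open>V(u, l)\<close> for different \<open>l\<close> are
disjoint (\<open>exact_cones_disjoint\<close>).

Let \<open>N\<close> be normal and amenable, and let \<open>g\<close> in \<open>N\<close> fix \<open>0\<close> without being a power of the shift. Then
\<open>g\<close> maps some finitely supported \<open>u\<close> to a configuration that is not a translate of \<open>u\<close>, and by
locality \<open>g\<close> moves \<open>U(u, K)\<close> off itself for large \<open>K\<close> (\<open>shift_Aut_moves_cone\<close>). The mean of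
\<open>N\<close> induces a mean on \<open>X\<close> that is invariant under the elements of \<open>N\<close> that fix \<open>0\<close> (\<open>base_image_mult\<close>).
It gives \<open>U(u, K)\<close> mass at most 1/2 and, by normality, also the images of \<open>U(u, K)\<close> under automorphisms
that fix \<open>0\<close>. Thus the preimage of \<open>U(u, K)\<close> under each toggle has mass at most 1/2,
so each \<open>V(u, l)\<close> has mass at least 1/2. As there are three disjoint sets of this kind, this is
impossible (\<open>not_amenable_of_three_sets\<close>, \<open>normal_amenable_fixing_zero\<close>).

It remains to exclude that an element \<open>g\<close> of \<open>N\<close> moves \<open>0\<close>. In that case, the commutator of
\<open>g\<close> with a suitable toggle lies in \<open>N\<close> and fixes \<open>0\<close>, but it is not a power of the shift
(\<open>commutator_fixing_zero\<close>), which contradicts the first case.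
\<close>

section \<open>Automorphisms of the full shift\<close>

abbreviation configs :: "nat \<Rightarrow> (int \<Rightarrow> nat) set"
  where "configs n \<equiv> {x. \<forall>m. x m < n}"

lemma openin_cylinder:
  assumes "x \<in> configs n" "finite I"
  shows "openin (full_shift n) {y \<in> configs n. \<forall>j\<in>I. y j = x j}"
proof -
  let ?U = "\<lambda>i. if i \<in> I then {x i} else {0..<n}"
  have "openin (full_shift n) (PiE UNIV ?U)"
    unfolding full_shift_def
  proof (rule product_topology_basis)
    show "\<And>i. openin (discrete_topology {0..<n}) (?U i)"
      using assms by auto
    show "finite {i. ?U i \<noteq> topspace (discrete_topology {0..<n})}"
      by (rule finite_subset[OF _ assms(2)]) auto
  qed
  also have "PiE UNIV ?U = {y \<in> configs n. \<forall>j\<in>I. y j = x j}"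
    using assms(1) by (auto simp: PiE_def Pi_def split: if_splits)
  finally show ?thesis .
qed

lemma shift_Aut_apply:
  assumes "f \<in> carrier (shift_Aut n)"
  shows "x \<in> configs n \<Longrightarrow> f x \<in> configs n"
    and "inj_on f (configs n)"
    and "x \<in> configs n \<Longrightarrow> f (\<lambda>m. x (m + 1)) = (\<lambda>m. f x (m + 1))"
    and "continuous_map (full_shift n) (full_shift n) f"
proof -
  have b: "bij_betw f (configs n) (configs n)" and "homeomorphic_map (full_shift n) (full_shift n) f"
    and c: "\<forall>x \<in> configs n. f (shift n x) = shift n (f x)"
    using assms by (auto simp: shift_Aut_def Bij_def topspace_full_shift)
  then show "continuous_map (full_shift n) (full_shift n) f" "inj_on f (configs n)"
    by (auto simp: homeomorphic_imp_continuous_map bij_betw_def)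
  show *: "f x \<in> configs n" if "x \<in> configs n" for x
    by (rule bij_betw_apply[OF b that])
  show "f (\<lambda>m. x (m + 1)) = (\<lambda>m. f x (m + 1))" if "x \<in> configs n"
    using c *[OF that] that by (simp add: shift_def topspace_full_shift)
qed

lemma shift_Aut_translate:
  assumes f: "f \<in> carrier (shift_Aut n)" and "x \<in> configs n"
  shows "f (\<lambda>m. x (m + k)) = (\<lambda>m. f x (m + k))"
  using assms(2)
proof (induction k arbitrary: x rule: int_induct[where k = 0])
  case base
  then show ?case by simp
next
  case (step1 i)
  have "(\<lambda>m. x (m + i)) \<in> configs n" using step1.prems by simp
  from shift_Aut_apply(3)[OF f this] show ?case
    by (simp add: step1.IH[OF step1.prems] add.assoc add.commute[of 1 i])
next
  case (step2 i)
  have "(\<lambda>m. x (m + (i - 1))) \<in> configs n" using step2.prems by simp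
  from shift_Aut_apply(3)[OF f this]
  have eq: "(\<lambda>m. f x (m + i)) = (\<lambda>m. f (\<lambda>m. x (m + (i - 1))) (m + 1))"
    by (simp add: step2.IH[OF step2.prems] add.assoc)
  have "f (\<lambda>m. x (m + (i - 1))) m = f x (m + (i - 1))" for m
    using fun_cong[OF eq, of "m - 1"] by (simp add: algebra_simps)
  then show ?case by blast
qed

text \<open>
The sliding block code property of the Curtis-Hedlund-Lyndon theorem, with the window \<open>[-r, r]\<close>.
\<close>

definition has_radius :: "nat \<Rightarrow> ((int \<Rightarrow> nat) \<Rightarrow> (int \<Rightarrow> nat)) \<Rightarrow> int \<Rightarrow> bool"
  where "has_radius n f r \<longleftrightarrow> 0 \<le> r \<and> (\<forall>x\<in>configs n. \<forall>y\<in>configs n. \<forall>m.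
    (\<forall>j. m - r \<le> j \<longrightarrow> j \<le> m + r \<longrightarrow> x j = y j) \<longrightarrow> f x m = f y m)"

lemma has_radiusD:
  assumes "has_radius n f r"
  shows "0 \<le> r"
    and "x \<in> configs n \<Longrightarrow> y \<in> configs n \<Longrightarrow>
      (\<And>j. m - r \<le> j \<Longrightarrow> j \<le> m + r \<Longrightarrow> x j = y j) \<Longrightarrow> f x m = f y m"
  using assms unfolding has_radius_def by blast+

text \<open>
Continuity alone gives every configuration its own window that determines the symbol at the origin of the
image; compactness makes the window uniform, and commuting with the shift carries it to all coordinates.
\<close>

lemma shift_Aut_local:
  assumes f: "f \<in> carrier (shift_Aut n)"
  obtains r where "has_radius n f r"
proof -
  \<comment> \<open>The sets \<open>D r\<close> of configurations at which radius \<open>r\<close> suffices form an increasing open cover.\<close>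
  define D where "D r = {x \<in> configs n. \<forall>y\<in>configs n. (\<forall>j\<in>{- int r..int r}. y j = x j) \<longrightarrow> f y 0 = f x 0}" for r
  have D_I: "x \<in> D r" if "x \<in> configs n"
    "\<And>y. y \<in> configs n \<Longrightarrow> (\<And>j. j \<in> {- int r..int r} \<Longrightarrow> y j = x j) \<Longrightarrow> f y 0 = f x 0" for x r
    unfolding D_def using that by blast
  have D_D: "f y 0 = f x 0" if "x \<in> D r" "y \<in> configs n" "\<And>j. j \<in> {- int r..int r} \<Longrightarrow> y j = x j" for x y r
    using that unfolding D_def by blast
  have D_sub: "D r \<subseteq> configs n" for r by (auto simp: D_def)
  have opD: "openin (full_shift n) (D r)" for r
  proof (subst openin_subopen, intro ballI)
    fix x assume x: "x \<in> D r"
    then have xc: "x \<in> configs n" using D_sub by blast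
    let ?C = "{y \<in> configs n. \<forall>j\<in>{- int r..int r}. y j = x j}"
    have "?C \<subseteq> D r"
    proof
      fix y assume "y \<in> ?C"
      then have y: "y \<in> configs n" "\<forall>j\<in>{- int r..int r}. y j = x j" by blast+
      have fy: "f y 0 = f x 0" by (rule D_D[OF x y(1)]) (rule bspec[OF y(2)])
      show "y \<in> D r"
      proof (rule D_I[OF y(1)])
        fix z assume z: "z \<in> configs n" "\<And>j. j \<in> {- int r..int r} \<Longrightarrow> z j = y j"
        have "z j = x j" if "j \<in> {- int r..int r}" for j
          using z(2)[OF that] bspec[OF y(2) that] by (rule trans)
        then show "f z 0 = f y 0" unfolding fy by (rule D_D[OF x z(1)])
      qed
    qed
    moreover have "openin (full_shift n) ?C"
      by (rule openin_cylinder[OF xc]) simp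
    moreover have "x \<in> ?C" using xc by blast
    ultimately show "\<exists>T. openin (full_shift n) T \<and> x \<in> T \<and> T \<subseteq> D r" by blast
  qed
  have mono: "D r \<subseteq> D s" if "r \<le> s" for r s
  proof
    fix x assume x: "x \<in> D r"
    show "x \<in> D s"
    proof (rule D_I)
      show "x \<in> configs n" using x D_sub by blast
      fix y assume "y \<in> configs n" "\<And>j. j \<in> {- int s..int s} \<Longrightarrow> y j = x j"
      then show "f y 0 = f x 0" using that by (intro D_D[OF x]) auto
    qed
  qed
  have "compact_space (full_shift n)"
    by (auto simp: full_shift_def compact_space_product_topology compact_space_discrete_topology)
  then have "compactin (full_shift n) (configs n)"
    by (simp add: compact_space_def topspace_full_shift)
  moreover have "\<And>U. U \<in> range D \<Longrightarrow> openin (full_shift n) U" using opD by blast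
  moreover have "configs n \<subseteq> \<Union> (range D)"
  proof
    fix x assume x: "x \<in> configs n"
    have "continuous_map (full_shift n) (discrete_topology {0..<n}) (\<lambda>x. f x 0)"
      using shift_Aut_apply(4)[OF f] unfolding full_shift_def continuous_map_componentwise_UNIV by blast
    from openin_continuous_map_preimage[OF this, of "{f x 0}"]
    have "openin (full_shift n) {y \<in> configs n. f y 0 = f x 0}"
      using shift_Aut_apply(1)[OF f x] by (simp add: topspace_full_shift)
    then obtain U where U: "finite {i \<in> UNIV. U i \<noteq> topspace (discrete_topology {0..<n})}"
      "x \<in> PiE UNIV U" "PiE UNIV U \<subseteq> {y \<in> configs n. f y 0 = f x 0}"
      using x unfolding full_shift_def openin_product_topology_alt by blast
    obtain r where r: "{i. U i \<noteq> {0..<n}} \<subseteq> {- int r..int r}"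
    proof -
      have "finite ((\<lambda>i. nat \<bar>i\<bar>) ` {i. U i \<noteq> {0..<n}})" using U(1) by simp
      then obtain r where "\<forall>k \<in> (\<lambda>i. nat \<bar>i\<bar>) ` {i. U i \<noteq> {0..<n}}. k \<le> r"
        using finite_nat_set_iff_bounded_le by blast
      then show ?thesis by (intro that[of r]) force
    qed
    have "y \<in> PiE UNIV U" if "y \<in> configs n" "\<forall>j\<in>{- int r..int r}. y j = x j" for y
    proof -
      have "y i \<in> U i" for i
      proof (cases "U i = {0..<n}")
        case False
        then have "y i = x i" using r that(2) by blast
        then show ?thesis using U(2) by auto
      qed (use that in auto)
      then show ?thesis by auto
    qed
    note inU = this
    have "x \<in> D r"
    proof (rule D_I[OF x])
      fix y assume y: "y \<in> configs n" "\<And>j. j \<in> {- int r..int r} \<Longrightarrow> y j = x j"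
      have "y \<in> PiE UNIV U" using inU[OF y(1)] y(2) by blast
      then show "f y 0 = f x 0" using U(3) by blast
    qed
    then show "x \<in> \<Union> (range D)" by blast
  qed
  ultimately have "\<exists>R. finite R \<and> R \<subseteq> range D \<and> configs n \<subseteq> \<Union> R"
    by (rule compactinD)
  then obtain R where R: "finite R" "R \<subseteq> range D" "configs n \<subseteq> \<Union> R" by blast
  then obtain I where I: "finite I" "R = D ` I" by (meson finite_subset_image)
  define s where "s = Max (insert 0 I)"
  have "D i \<subseteq> D s" if "i \<in> I" for i using I(1) that by (intro mono) (simp add: s_def)
  then have full: "configs n \<subseteq> D s" using R(3) I(2) by blast
  show ?thesis
  proof (rule that[of "int s"], unfold has_radius_def, intro conjI ballI allI impI)
    fix x y :: "int \<Rightarrow> nat" and m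
    assume xy: "x \<in> configs n" "y \<in> configs n" and
      eq: "\<forall>j. m - int s \<le> j \<longrightarrow> j \<le> m + int s \<longrightarrow> x j = y j"
    have "(\<lambda>i. x (i + m)) \<in> configs n" using xy(1) by simp
    then have "(\<lambda>i. x (i + m)) \<in> D s" by (rule subsetD[OF full])
    then have "f (\<lambda>i. y (i + m)) 0 = f (\<lambda>i. x (i + m)) 0"
      by (rule D_D) (use xy(2) eq in simp_all)
    then show "f x m = f y m" by (simp add: shift_Aut_translate[OF f xy(1)] shift_Aut_translate[OF f xy(2)])
  qed simp
qed

text \<open>
A local map is continuous, and an involution serves as its own continuous inverse. The map is restricted because group elements are undefined outside of the space.
\<close>

lemma local_involution_in_shift_Aut:
  assumes maps: "\<And>x. x \<in> configs n \<Longrightarrow> T x \<in> configs n"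
    and inv: "\<And>x. T (T x) = x"
    and trans: "\<And>x. T (\<lambda>m. x (m + 1)) = (\<lambda>m. T x (m + 1))"
    and loc: "\<And>x y m. (\<And>j. m - r \<le> j \<Longrightarrow> j \<le> m + r \<Longrightarrow> x j = y j) \<Longrightarrow> T x m = T y m"
  shows "restrict T (configs n) \<in> carrier (shift_Aut n)"
proof -
  have cont: "continuous_map (full_shift n) (full_shift n) T"
  proof -
    have "continuous_map (full_shift n) (discrete_topology {0..<n}) (\<lambda>x. T x m)" for m
      unfolding continuous_map_def
    proof (intro conjI allI impI)
      show "(\<lambda>x. T x m) \<in> topspace (full_shift n) \<rightarrow> topspace (discrete_topology {0..<n})"
        using maps by (auto simp: topspace_full_shift)
      fix U show "openin (full_shift n) {x \<in> topspace (full_shift n). T x m \<in> U}"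
      proof (subst openin_subopen, intro ballI)
        fix x assume x: "x \<in> {x \<in> topspace (full_shift n). T x m \<in> U}"
        let ?C = "{y \<in> configs n. \<forall>j\<in>{m - r..m + r}. y j = x j}"
        have "openin (full_shift n) ?C"
          using x by (intro openin_cylinder) (auto simp: topspace_full_shift)
        moreover have "?C \<subseteq> {x \<in> topspace (full_shift n). T x m \<in> U}"
        proof
          fix y assume y: "y \<in> ?C"
          then have "T y m = T x m" by (intro loc) auto
          then show "y \<in> {x \<in> topspace (full_shift n). T x m \<in> U}"
            using x y by (simp add: topspace_full_shift)
        qed
        moreover have "x \<in> ?C" using x by (simp add: topspace_full_shift)
        ultimately show "\<exists>C. openin (full_shift n) C \<and> x \<in> C \<and> C \<subseteq> {x \<in> topspace (full_shift n). T x m \<in> U}"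
          by blast
      qed
    qed
    then have "continuous_map (full_shift n) (product_topology (\<lambda>_. discrete_topology {0..<n}) UNIV) T"
      unfolding continuous_map_componentwise_UNIV by blast
    then show ?thesis by (simp add: full_shift_def)
  qed
  have "homeomorphic_map (full_shift n) (full_shift n) T"
    unfolding homeomorphic_map_maps homeomorphic_maps_def using cont inv by blast
  then have h: "homeomorphic_map (full_shift n) (full_shift n) (restrict T (configs n))"
    by (rule homeomorphic_map_eq) (simp add: topspace_full_shift)
  then have "restrict T (configs n) \<in> Bij (configs n)"
    unfolding Bij_def bij_betw_def homeomorphic_eq_everything_map by (auto simp: topspace_full_shift)
  with h show ?thesis
    using maps trans by (simp add: shift_Aut_def shift_def topspace_full_shift)
qed

lemma shift_Aut_mult_apply:
  assumes "f \<in> carrier (shift_Aut n)" "g \<in> carrier (shift_Aut n)" "x \<in> configs n"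
  shows "(f \<otimes>\<^bsub>shift_Aut n\<^esub> g) x = f (g x)"
  using assms by (simp add: shift_Aut_def BijGroup_def topspace_full_shift compose_def)

lemma shift_Aut_one_apply: "x \<in> configs n \<Longrightarrow> \<one>\<^bsub>shift_Aut n\<^esub> x = x"
  by (simp add: shift_Aut_def BijGroup_def topspace_full_shift)

lemma shift_Aut_eqI:
  assumes "f \<in> carrier (shift_Aut n)" "g \<in> carrier (shift_Aut n)" "\<And>x. x \<in> configs n \<Longrightarrow> f x = g x"
  shows "f = g"
  using assms by (intro extensionalityI[of f "configs n" g]) (auto simp: shift_Aut_def Bij_def topspace_full_shift)

lemma shift_Aut_inv_apply:
  assumes "f \<in> carrier (shift_Aut n)" "x \<in> configs n"
  shows "f ((inv\<^bsub>shift_Aut n\<^esub> f) x) = x" "(inv\<^bsub>shift_Aut n\<^esub> f) (f x) = x"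
proof -
  interpret G: group "shift_Aut n" by (rule group_shift_Aut)
  show "f ((inv\<^bsub>shift_Aut n\<^esub> f) x) = x"
    using shift_Aut_mult_apply[of f n "inv\<^bsub>shift_Aut n\<^esub> f" x] assms by (simp add: shift_Aut_one_apply)
  show "(inv\<^bsub>shift_Aut n\<^esub> f) (f x) = x"
    using shift_Aut_mult_apply[of "inv\<^bsub>shift_Aut n\<^esub> f" n f x] assms by (simp add: shift_Aut_one_apply)
qed

section \<open>Toggling a pattern\<close>

text \<open>
A marker is the position of the first symbol of \<open>y\<close> in a block \<open>00y\<close> or \<open>0vy\<close>, where \<open>0\<close> stands
for \<open>l\<close> zeros, \<open>v\<close> for the first \<open>l\<close> symbols of \<open>u\<close>, and \<open>y\<close> begins with a nonzero symbol but not
with the first \<open>K\<close> symbols of \<open>u\<close>. The condition on \<open>y\<close> keeps the beginning of an inserted \<open>v\<close>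
from being a marker itself.
\<close>

definition markers :: "(int \<Rightarrow> nat) \<Rightarrow> int \<Rightarrow> int \<Rightarrow> (int \<Rightarrow> nat) \<Rightarrow> int set"
  where "markers u K l x = {f. x f \<noteq> 0 \<and> (\<forall>j\<in>{f - 2 * l..<f - l}. x j = 0) \<and>
    ((\<forall>j\<in>{f - l..<f}. x j = 0) \<or> (\<forall>j\<in>{f - l..<f}. x j = u (j - (f - l)))) \<and>
    \<not> (\<forall>j\<in>{f..<f + K}. x j = u (j - f))}"

text \<open>
At every marker, \<open>00y\<close> and \<open>0vy\<close> are exchanged. As \<open>u\<close> starts with a nonzero symbol, the first symbol
of the block in front of the marker tells which of the two is present.
\<close>

definition toggle :: "(int \<Rightarrow> nat) \<Rightarrow> int \<Rightarrow> int \<Rightarrow> (int \<Rightarrow> nat) \<Rightarrow> (int \<Rightarrow> nat)"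
  where "toggle u K l x = (\<lambda>j. if \<exists>f\<in>markers u K l x. f - l \<le> j \<and> j < f
    then let f = (THE f. f \<in> markers u K l x \<and> f - l \<le> j \<and> j < f)
         in if x (f - l) = 0 then u (j - (f - l)) else 0
    else x j)"

lemma markers_cong_imp:
  assumes "f \<in> markers u K l x" "0 < K" "K \<le> l"
    "\<And>j. f - 2 * l \<le> j \<Longrightarrow> j < f + K \<Longrightarrow> x j = y j"
  shows "f \<in> markers u K l y"
  using assms by (auto simp: markers_def)

lemma markers_cong:
  assumes "0 < K" "K \<le> l" "\<And>j. f - 2 * l \<le> j \<Longrightarrow> j < f + K \<Longrightarrow> x j = y j"
  shows "f \<in> markers u K l x \<longleftrightarrow> f \<in> markers u K l y"
  using markers_cong_imp[of f u K l x y] markers_cong_imp[of f u K l y x] assms by metis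

lemma markers_translate:
  "f \<in> markers u K l (\<lambda>m. x (m + k)) \<longleftrightarrow> f + k \<in> markers u K l x"
proof -
  have *: "(\<forall>j\<in>{a..<b}. P (j + k)) \<longleftrightarrow> (\<forall>j\<in>{a + k..<b + k}. P j)" for a b and P :: "int \<Rightarrow> bool"
  proof -
    have "P j" if "\<forall>j\<in>{a..<b}. P (j + k)" "j \<in> {a + k..<b + k}" for j
      using bspec[OF that(1), of "j - k"] that(2) by simp
    then show ?thesis by auto
  qed
  show ?thesis
    using *[of "f - 2 * l" "f - l" "\<lambda>j. x j = 0"] *[of "f - l" f "\<lambda>j. x j = 0"]
      *[of "f - l" f "\<lambda>j. x j = u (j - (f + k - l))"] *[of f "f + K" "\<lambda>j. x j = u (j - (f + k))"]
    by (simp add: markers_def algebra_simps del: ball_simps)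
qed

locale toggle_pattern =
  fixes u :: "int \<Rightarrow> nat" and K l :: int
  assumes u_0: "u 0 \<noteq> 0" and K_pos: "0 < K" and K_le_l: "K \<le> l"
begin

text \<open>
This is what makes the exchange consistent: the window \<open>[f - 2l, f + K)\<close> that decides whether \<open>f\<close> is a
marker never meets the block that is rewritten at another marker. Two markers \<open>f < g\<close> that are too close
would force \<open>f\<close> into the block \<open>v\<close> in front of \<open>g\<close>. If \<open>f\<close> is its first position, then \<open>f\<close> is
followed by the beginning of \<open>u\<close> and is no marker; otherwise the first symbol of \<open>v\<close> lies in the block in
front of \<open>f\<close>, which is then itself a copy of \<open>v\<close> that begins where \<open>g\<close> requires zeros.
\<close>

lemma markers_separated:
  assumes f: "f \<in> markers u K l x" and g: "g \<in> markers u K l x" and "f < g"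
  shows "f + 2 * l < g"
proof (rule ccontr)
  assume "\<not> f + 2 * l < g"
  have "x f \<noteq> 0" using f by (simp add: markers_def)
  moreover have "x j = 0" if "g - 2 * l \<le> j" "j < g - l" for j
    using g that by (simp add: markers_def)
  ultimately have "\<not> (g - 2 * l \<le> f \<and> f < g - l)" by metis
  then have gl: "g - l \<le> f"
    using \<open>\<not> f + 2 * l < g\<close> by linarith
  then have "\<not> (\<forall>j\<in>{g - l..<g}. x j = 0)"
    using \<open>x f \<noteq> 0\<close> \<open>f < g\<close> by auto
  then have blk: "x j = u (j - (g - l))" if "g - l \<le> j" "j < g" for j
    using g that by (auto simp: markers_def)
  have gl0: "x (g - l) \<noteq> 0"
    using blk[of "g - l"] u_0 K_pos K_le_l by simp
  show False
  proof (cases "f = g - l")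
    case True
    then have "\<forall>j\<in>{f..<f + K}. x j = u (j - f)"
      using blk K_le_l by simp
    then show False using f by (simp add: markers_def)
  next
    case False
    then have "g - l < f" "f - l \<le> g - l" using gl \<open>f < g\<close> by auto
    then have "\<not> (\<forall>j\<in>{f - l..<f}. x j = 0)" using gl0 by auto
    then have "x (f - l) = u 0" using f K_pos K_le_l by (auto simp: markers_def)
    moreover have "x (f - l) = 0"
      using g \<open>g - l < f\<close> \<open>f < g\<close> gl by (simp add: markers_def)
    ultimately show False using u_0 by simp
  qed
qed

lemma toggle_at:
  assumes f: "f \<in> markers u K l x" and j: "f - l \<le> j" "j < f"
  shows "toggle u K l x j = (if x (f - l) = 0 then u (j - (f - l)) else 0)"
proof -
  have "(THE f. f \<in> markers u K l x \<and> f - l \<le> j \<and> j < f) = f"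
  proof (rule the_equality)
    fix g assume g: "g \<in> markers u K l x \<and> g - l \<le> j \<and> j < g"
    show "g = f"
      using markers_separated[OF f, of g] markers_separated[OF _ f, of g] g j K_pos K_le_l by force
  qed (use assms in simp)
  then show ?thesis using assms unfolding toggle_def Let_def by auto
qed

lemma toggle_off:
  assumes "\<And>f. f \<in> markers u K l x \<Longrightarrow> j < f - l \<or> f \<le> j"
  shows "toggle u K l x j = x j"
  using assms unfolding toggle_def by force

lemma toggle_near_marker:
  assumes f: "f \<in> markers u K l x" and j: "f - 2 * l \<le> j" "j < f + K" "j < f - l \<or> f \<le> j"
  shows "toggle u K l x j = x j"
proof (rule toggle_off)
  fix g assume g: "g \<in> markers u K l x"
  show "j < g - l \<or> g \<le> j"
    using markers_separated[OF f g] markers_separated[OF g f] j K_le_l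
    by (cases f g rule: linorder_cases) auto
qed

lemma marker_block:
  assumes f: "f \<in> markers u K l x" and j: "f - l \<le> j" "j < f"
  shows "x j = (if x (f - l) = 0 then 0 else u (j - (f - l)))"
  using assms u_0 by (auto simp: markers_def)

lemma marker_toggle_marker:
  assumes f: "f \<in> markers u K l x"
  shows "f \<in> markers u K l (toggle u K l x)"
proof -
  let ?y = "toggle u K l x"
  have y: "?y j = x j" if "f - 2 * l \<le> j" "j < f + K" "j < f - l \<or> f \<le> j" for j
    using toggle_near_marker[OF f that] .
  have "?y f = x f" using y[of f] K_pos K_le_l by simp
  moreover have "\<forall>j\<in>{f - 2 * l..<f - l}. ?y j = x j" using y K_pos K_le_l by simp
  moreover have "\<forall>j\<in>{f..<f + K}. ?y j = x j" using y K_pos K_le_l by simp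
  moreover have "\<forall>j\<in>{f - l..<f}. ?y j = (if x (f - l) = 0 then u (j - (f - l)) else 0)"
    using toggle_at[OF f] by simp
  ultimately show ?thesis using f unfolding markers_def by auto
qed

text \<open>
Rewriting at a marker does not touch the windows of the others, so no marker is lost. A new marker would
need a change inside its window, made at an old marker; but both are markers of the new configuration,
where markers are separated as well.
\<close>

lemma markers_toggle: "markers u K l (toggle u K l x) = markers u K l x"
proof (intro equalityI subsetI)
  fix f assume f: "f \<in> markers u K l (toggle u K l x)"
  have "toggle u K l x j = x j" if f': "f \<notin> markers u K l x" and j: "f - 2 * l \<le> j" "j < f + K" for j
  proof (rule toggle_off)
    fix g assume g: "g \<in> markers u K l x"
    then have "g \<noteq> f" "g \<in> markers u K l (toggle u K l x)" using f' marker_toggle_marker by auto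
    then show "j < g - l \<or> g \<le> j"
      using markers_separated[OF f, of g] markers_separated[OF _ f, of g] j K_le_l
      by (cases f g rule: linorder_cases) auto
  qed
  then show "f \<in> markers u K l x"
    using f markers_cong[OF K_pos K_le_l, of f "toggle u K l x" x u] by blast
qed (rule marker_toggle_marker)

lemma toggle_toggle: "toggle u K l (toggle u K l x) = x"
proof
  fix j
  show "toggle u K l (toggle u K l x) j = x j"
  proof (cases "\<exists>f\<in>markers u K l x. f - l \<le> j \<and> j < f")
    case True
    then obtain f where f: "f \<in> markers u K l x" "f - l \<le> j" "j < f" by blast
    have "toggle u K l (toggle u K l x) j = (if toggle u K l x (f - l) = 0 then u (j - (f - l)) else 0)"
      using f by (intro toggle_at) (simp_all add: markers_toggle)
    moreover have "toggle u K l x (f - l) = (if x (f - l) = 0 then u 0 else 0)"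
      using toggle_at[OF f(1), of "f - l"] f by simp
    ultimately show ?thesis using marker_block[OF f] u_0 by auto
  next
    case False
    then have "toggle u K l x j = x j" "toggle u K l (toggle u K l x) j = toggle u K l x j"
      by (intro toggle_off; force simp: markers_toggle)+
    then show ?thesis by simp
  qed
qed

lemma toggle_translate: "toggle u K l (\<lambda>m. x (m + k)) = (\<lambda>m. toggle u K l x (m + k))"
proof
  fix j
  show "toggle u K l (\<lambda>m. x (m + k)) j = toggle u K l x (j + k)"
  proof (cases "\<exists>f\<in>markers u K l x. f - l \<le> j + k \<and> j + k < f")
    case True
    then obtain f where f: "f \<in> markers u K l x" "f - l \<le> j + k" "j + k < f" by blast
    have "toggle u K l (\<lambda>m. x (m + k)) j = (if x (f - k - l + k) = 0 then u (j - (f - k - l)) else 0)"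
      by (rule toggle_at) (use f in \<open>simp_all add: markers_translate\<close>)
    then show ?thesis using toggle_at[OF f] by (simp add: algebra_simps)
  next
    case False
    have "toggle u K l (\<lambda>m. x (m + k)) j = x (j + k)"
      by (rule toggle_off) (use False in \<open>force simp: markers_translate\<close>)
    moreover have "toggle u K l x (j + k) = x (j + k)"
      by (rule toggle_off) (use False in force)
    ultimately show ?thesis by simp
  qed
qed

lemma toggle_local:
  assumes eq: "\<And>j. m - 2 * l \<le> j \<Longrightarrow> j \<le> m + 2 * l \<Longrightarrow> x j = y j"
  shows "toggle u K l x m = toggle u K l y m"
proof -
  have mk: "f \<in> markers u K l x \<longleftrightarrow> f \<in> markers u K l y" if "f - l \<le> m" "m < f" for f
    by (rule markers_cong[OF K_pos K_le_l], rule eq) (use that K_le_l in auto)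
  show ?thesis
  proof (cases "\<exists>f\<in>markers u K l x. f - l \<le> m \<and> m < f")
    case True
    then obtain f where f: "f \<in> markers u K l x" "f - l \<le> m" "m < f" by blast
    then have "x (f - l) = y (f - l)" by (intro eq) auto
    then show ?thesis using toggle_at[OF f] toggle_at[of f y m] mk f by simp
  next
    case False
    have "toggle u K l x m = x m" by (rule toggle_off) (use False in force)
    moreover have "toggle u K l y m = y m" by (rule toggle_off) (use False mk in force)
    ultimately show ?thesis using eq[of m] K_pos K_le_l by simp
  qed
qed

lemma toggle_configs:
  assumes "u \<in> configs n" "x \<in> configs n"
  shows "toggle u K l x \<in> configs n"
proof -
  have "0 < n" using assms by (metis (lifting) gr_zeroI mem_Collect_eq not_less_zero)
  then show ?thesis using assms by (auto simp: toggle_def Let_def)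
qed

lemma toggle_in_shift_Aut:
  assumes "u \<in> configs n"
  shows "restrict (toggle u K l) (configs n) \<in> carrier (shift_Aut n)"
  by (rule local_involution_in_shift_Aut[OF toggle_configs[OF assms] toggle_toggle toggle_translate toggle_local])

end

section \<open>Cones\<close>

text \<open>
For a pattern \<open>u\<close> that vanishes on the negative coordinates, these are the configurations whose part from the
first nonzero coordinate on begins with the first \<open>K\<close> symbols of \<open>u\<close>. The single equation also
covers the zeros on the left.
\<close>

definition cone :: "(int \<Rightarrow> nat) \<Rightarrow> int \<Rightarrow> (int \<Rightarrow> nat) set"
  where "cone u K = {x. \<exists>f. \<forall>j<f + K. x j = u (j - f)}"

text \<open>
For \<open>u\<close> vanishing from \<open>l\<close> on, the length of the copy of \<open>u\<close> can be read off from the configuration,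
since it is followed by a nonzero symbol. A toggle sends configurations with a first nonzero coordinate that lie
outside of the cone to such a set.
\<close>

definition exact_cone :: "(int \<Rightarrow> nat) \<Rightarrow> int \<Rightarrow> (int \<Rightarrow> nat) set"
  where "exact_cone u l = {x. \<exists>f. (\<forall>j<f + l. x j = u (j - f)) \<and> x (f + l) \<noteq> 0}"

context toggle_pattern
begin

context
  assumes u_neg: "\<And>j. j < 0 \<Longrightarrow> u j = 0"
begin

lemma toggle_inserts_pattern:
  assumes f: "x f \<noteq> 0" "\<And>j. j < f \<Longrightarrow> x j = 0" and off: "\<not> (\<forall>j\<in>{f..<f + K}. x j = u (j - f))"
    and "j < f"
  shows "toggle u K l x j = u (j - (f - l))"
proof -
  have mk: "f \<in> markers u K l x" using f off K_pos K_le_l by (simp add: markers_def)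
  show ?thesis
  proof (cases "f - l \<le> j")
    case True
    then show ?thesis using toggle_at[OF mk True \<open>j < f\<close>] f(2)[of "f - l"] K_pos K_le_l by simp
  next
    case False
    have "toggle u K l x j = x j"
    proof (rule toggle_off)
      fix g assume "g \<in> markers u K l x"
      then have "x g \<noteq> 0" by (simp add: markers_def)
      then have "f \<le> g" using f(2) by (meson not_le)
      then show "j < g - l \<or> g \<le> j" using False by simp
    qed
    then show ?thesis using f(2)[OF \<open>j < f\<close>] u_neg[of "j - (f - l)"] False by simp
  qed
qed

text \<open>
Outside of the cone, the first nonzero coordinate is a marker and the toggle inserts a copy of \<open>u\<close> in front of
it. Inside of the cone, the first nonzero coordinate \<open>f\<close> is no marker, and the toggle can change one of
the next \<open>K\<close> symbols only if the block in front of a marker starts at \<open>f\<close>; then that marker is the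
nonzero symbol at \<open>f + l\<close> and the configuration lies in the exact cone.
\<close>

lemma toggle_maps_into_cone:
  assumes f: "x f \<noteq> 0" "\<And>j. j < f \<Longrightarrow> x j = 0" and "x \<notin> exact_cone u l"
  shows "toggle u K l x \<in> cone u K"
proof (cases "\<forall>j\<in>{f..<f + K}. x j = u (j - f)")
  case False
  from toggle_inserts_pattern[OF f False]
  have "\<forall>j<(f - l) + K. toggle u K l x j = u (j - (f - l))" using K_le_l by simp
  then show ?thesis unfolding cone_def by blast
next
  case True
  have xu: "x j = u (j - f)" if "j < f + K" for j
    using True f(2)[of j] u_neg[of "j - f"] that by (cases "j < f") auto
  have "toggle u K l x j = x j" if j: "j < f + K" for j
  proof (rule toggle_off, rule ccontr)
    fix g assume g: "g \<in> markers u K l x" and "\<not> (j < g - l \<or> g \<le> j)"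
    then have "g - l \<le> j" "j < g" by auto
    have xg: "x g \<noteq> 0" using g by (simp add: markers_def)
    have "g \<noteq> f" using g True by (auto simp: markers_def)
    then have "f < g" using xg f(2)[of g] by (cases f g rule: linorder_cases) auto
    moreover have "\<not> (g - 2 * l \<le> f \<and> f < g - l)" using g f(1) by (auto simp: markers_def)
    ultimately have "g - l \<le> f" using j \<open>g - l \<le> j\<close> K_le_l by linarith
    then have "x (g - l) \<noteq> 0" using marker_block[OF g \<open>g - l \<le> f\<close> \<open>f < g\<close>] f(1) by (auto split: if_splits)
    then have fg: "f = g - l" using f(2)[of "g - l"] \<open>g - l \<le> f\<close> by force
    have "x i = u (i - f)" if "i < f + l" for i
    proof (cases "i < f")
      case False
      then show ?thesis using marker_block[OF g, of i] \<open>x (g - l) \<noteq> 0\<close> that fg by simp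
    qed (use f(2) u_neg in simp)
    moreover have "x (f + l) \<noteq> 0" using xg fg by simp
    ultimately have "x \<in> exact_cone u l" unfolding exact_cone_def by blast
    then show False using assms(3) by blast
  qed
  then have "\<forall>j<f + K. toggle u K l x j = u (j - f)" using xu by simp
  then show ?thesis unfolding cone_def by blast
qed

end

end

lemma exact_cones_disjoint:
  assumes "u 0 \<noteq> 0" "\<And>j. j < 0 \<Longrightarrow> u j = 0" "0 < l" "l < l'" "u l = 0"
  shows "exact_cone u l \<inter> exact_cone u l' = {}"
proof -
  have False if x: "\<And>j. j < f + l \<Longrightarrow> x j = u (j - f)" "x (f + l) \<noteq> 0" and y: "\<And>j. j < g + l' \<Longrightarrow> x j = u (j - g)" for x f g
  proof -
    have "x f = u 0" "x g = u 0" using x(1)[of f] y[of g] assms by auto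
    then have "f = g"
      using x(1)[of g] y[of f] assms(1) assms(2)[of "g - f"] assms(2)[of "f - g"] assms(3,4)
      by (cases f g rule: linorder_cases) auto
    then show False using y[of "f + l"] x(2) assms by simp
  qed
  then show ?thesis unfolding exact_cone_def by blast
qed

section \<open>Automorphisms that are not powers of the shift\<close>

lemma obtain_first_nonzero:
  fixes x :: "int \<Rightarrow> nat"
  assumes "x t \<noteq> 0" "\<And>j. j < b \<Longrightarrow> x j = 0"
  obtains f where "x f \<noteq> 0" "\<And>j. j < f \<Longrightarrow> x j = 0"
proof -
  let ?P = "\<lambda>i. x (b + int i) \<noteq> 0"
  have "?P (nat (t - b))" using assms(1) assms(2)[of t] by (cases "t < b") auto
  then have L: "?P (Least ?P)" by (rule LeastI)
  have "x j = 0" if "j < b + int (Least ?P)" for j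
  proof (cases "j < b")
    case False
    then have "nat (j - b) < Least ?P" using that by simp
    then have "\<not> ?P (nat (j - b))" by (rule not_less_Least)
    then show ?thesis using False by simp
  qed (use assms(2) in simp)
  with L show ?thesis by (rule that)
qed

text \<open>
If \<open>K\<close> is large, a configuration \<open>x\<close> in the cone and \<open>u\<close> agree for so long, after a translation, that \<open>g x\<close> and
\<open>g u\<close> agree beyond the support of \<open>g u\<close>. If \<open>g x\<close> were in the cone as well, then \<open>g u\<close> would agree
with a translate of \<open>u\<close> on the whole of both supports.
\<close>

lemma shift_Aut_moves_cone:
  assumes g: "g \<in> carrier (shift_Aut n)" and g0: "g (\<lambda>_. 0) = (\<lambda>_. 0)"
    and u: "u \<in> configs n" "u 0 \<noteq> 0" "\<forall>j<0. u j = 0" "\<forall>j>a. u j = 0"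
    and gu: "\<forall>k. g u \<noteq> (\<lambda>m. u (m + k))"
  obtains K0 where "\<forall>K\<ge>K0. \<forall>x\<in>configs n. x \<in> cone u K \<longrightarrow> g x \<notin> cone u K"
proof -
  obtain r where "has_radius n g r" by (rule shift_Aut_local[OF g])
  note r = has_radiusD[OF this]
  have un: "u j = 0" if "j < 0 \<or> a < j" for j using u(3,4) that by blast
  have a: "0 \<le> a" using u(2) un[of 0] by force
  have "0 < n" using u(1) by (metis (lifting) gr_zeroI mem_Collect_eq not_less_zero)
  then have z: "(\<lambda>_. 0) \<in> configs n" by simp
  have gu0: "g u j = 0" if "j < - r \<or> a + r < j" for j
    using r(2)[OF u(1) z, of j] un that unfolding g0 by fastforce
  have "g u \<noteq> (\<lambda>_. 0)"
  proof
    assume "g u = (\<lambda>_. 0)"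
    then have "u = (\<lambda>_. 0)"
      using inj_onD[OF shift_Aut_apply(2)[OF g] _ u(1) z] g0 by simp
    then show False using u(2) by simp
  qed
  then obtain t where t: "g u t \<noteq> 0" by auto
  then have ta: "t \<le> a + r" using gu0[of t] by force
  show ?thesis
  proof (rule that[of "2 * a + 2 * r + 1"], intro allI ballI impI notI)
    fix K x assume K: "2 * a + 2 * r + 1 \<le> K" and x: "x \<in> configs n" "x \<in> cone u K" and gx: "g x \<in> cone u K"
    from x(2) obtain f where f: "\<And>j. j < f + K \<Longrightarrow> x j = u (j - f)" unfolding cone_def by blast
    from gx obtain q where q: "\<And>j. j < q + K \<Longrightarrow> g x j = u (j - q)" unfolding cone_def by blast
    define p where "p = q - f"
    let ?y = "\<lambda>m. x (m + f)"
    have y: "?y \<in> configs n" using x(1) by simp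
    have gy: "g ?y j = g x (j + f)" for j by (simp add: shift_Aut_translate[OF g x(1)])
    have 1: "g ?y j = g u j" if "j < K - r" for j
      using that by (intro r(2)[OF y u(1)]) (simp add: f)
    have 2: "g ?y j = u (j - p)" if "j < p + K" for j
      using q[of "j + f"] that by (simp add: gy p_def algebra_simps)
    \<comment> \<open>The agreement of \<open>g ?y\<close> and \<open>g u\<close> below \<open>K - r\<close> bounds the position \<open>p\<close> of the copy of \<open>u\<close> in \<open>g ?y\<close>.\<close>
    have "p \<le> t"
    proof (rule ccontr)
      assume "\<not> p \<le> t"
      then show False using 1[of t] 2[of t] t ta un[of "t - p"] K a r(1) by simp
    qed
    then have pK: "p < K - r" using ta K a r(1) by simp
    then have "g u p \<noteq> 0" using 1[of p] 2[of p] u(2) K a r(1) by simp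
    then have p: "- r \<le> p" "p \<le> a + r" using gu0[of p] by force+
    have "g u j = u (j - p)" for j
    proof (cases "j < K - r \<and> j < p + K")
      case True
      then show ?thesis using 1[of j] 2[of j] by simp
    next
      case False
      then have "a + r < j" "a < j - p" using K p a r(1) by auto
      then show ?thesis using gu0[of j] un[of "j - p"] by simp
    qed
    then have "g u = (\<lambda>m. u (m + - p))" by auto
    then show False using gu by blast
  qed
qed

text \<open>
The amount of translation could a priori depend on the configuration. To see that \<open>y\<close> is moved by as much as the
configuration \<open>d\<close> with a single 1, place a copy of \<open>d\<close> far to the right of \<open>y\<close>. By locality, the first nonzero symbol
of the result moves with \<open>y\<close> and the last one with \<open>d\<close>, but the result is translated as a whole.
Finitely supported configurations then determine the automorphism, by locality.
\<close>

lemma shift_AutI_finite_support: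
  assumes n: "2 \<le> n" and g: "g \<in> carrier (shift_Aut n)" and g0: "g (\<lambda>_. 0) = (\<lambda>_. 0)"
    and fin: "\<And>y a. y \<in> configs n \<Longrightarrow> y \<noteq> (\<lambda>_. 0) \<Longrightarrow> (\<And>j. a < \<bar>j\<bar> \<Longrightarrow> y j = 0) \<Longrightarrow> \<exists>k. g y = (\<lambda>m. y (m + k))"
  shows "g \<in> shift_powers n"
proof -
  obtain r where "has_radius n g r" by (rule shift_Aut_local[OF g])
  note r = has_radiusD[OF this]
  define d :: "int \<Rightarrow> nat" where "d = (\<lambda>j. if j = 0 then 1 else 0)"
  have d: "d \<in> configs n" using n by (simp add: d_def)
  have "d \<noteq> (\<lambda>_. 0)" by (metis d_def zero_neq_one)
  then obtain k where k: "g d = (\<lambda>m. d (m + k))"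
    using fin[OF d, of 0] by (auto simp: d_def)
  have same: "g y = (\<lambda>m. y (m + k))"
    if y: "y \<in> configs n" "y \<noteq> (\<lambda>_. 0)" "\<And>j. a < \<bar>j\<bar> \<Longrightarrow> y j = 0" for y a
  proof -
    obtain k' where k': "g y = (\<lambda>m. y (m + k'))" using fin[OF y] by blast
    obtain t where "y t \<noteq> 0" using y(2) by auto
    then obtain p where p: "y p \<noteq> 0" "\<And>j. j < p \<Longrightarrow> y j = 0"
      by (rule obtain_first_nonzero[of y t "- a"]) (use y(3) in auto)
    have pa: "p \<le> a" using y(3)[of p] p(1) by force
    have a: "0 \<le> a" using y(3)[of p] p(1) by force
    define D where "D = a + r + 1 + \<bar>k\<bar> + \<bar>k'\<bar>"
    define z where "z = (\<lambda>j. if j = D then 1 else y j)"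
    have z: "z \<in> configs n" using y(1) n by (simp add: z_def)
    have Dp: "p < D" using pa r(1) by (simp add: D_def)
    have zD: "z D \<noteq> 0" by (simp add: z_def)
    have zD': "z j = 0" if "D < j" for j
      using that y(3)[of j] a r(1) by (simp add: z_def D_def)
    have zp: "z p \<noteq> 0" using p(1) by (simp add: z_def)
    have zp': "z j = 0" if "j < p" for j
      using that p(2) Dp by (simp add: z_def)
    have "z \<noteq> (\<lambda>_. 0)" using zD by auto
    moreover have "z j = 0" if "D < \<bar>j\<bar>" for j
      using that y(3)[of j] a r(1) by (simp add: z_def D_def)
    ultimately obtain k'' where k'': "g z = (\<lambda>m. z (m + k''))"
      using fin[OF z] by blast
    have left: "g z j = y (j + k')" if "j + r < D" for j
      using r(2)[OF z y(1), of j] that by (simp add: z_def k')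
    have right: "g z j = d (j - D + k)" if "a < j - r" for j
    proof -
      have "(\<lambda>m. d (m + - D)) \<in> configs n" using d by simp
      then have "g z j = g (\<lambda>m. d (m + - D)) j"
        by (rule r(2)[OF z]) (use y(3) that in \<open>auto simp: z_def d_def\<close>)
      then show ?thesis unfolding shift_Aut_translate[OF g d] by (simp add: k)
    qed
    have "z (p - k' + k'') \<noteq> 0" using left[of "p - k'"] p(1) pa by (simp add: k'' D_def)
    then have "k' \<le> k''" using zp'[of "p - k' + k''"] by force
    moreover have "k'' \<le> k'"
    proof (rule ccontr)
      assume "\<not> k'' \<le> k'"
      then have "g z (p - k'') = 0" using left[of "p - k''"] p(2) pa by (simp add: D_def)
      then show False using zp by (simp add: k'')
    qed
    moreover have "z (D - k + k'') \<noteq> 0" using right[of "D - k"] by (simp add: k'' D_def d_def)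
    then have "k'' \<le> k" using zD'[of "D - k + k''"] by force
    moreover have "k \<le> k''"
    proof (rule ccontr)
      assume "\<not> k \<le> k''"
      then have "g z (D - k'') = 0" using right[of "D - k''"] by (simp add: D_def d_def)
      then show False using zD by (simp add: k'')
    qed
    ultimately show ?thesis using k' by simp
  qed
  have "g x = (\<lambda>m. x (m + k))" if x: "x \<in> configs n" for x
  proof
    fix m
    define y where "y = (\<lambda>j. if \<bar>j\<bar> \<le> \<bar>m\<bar> + r + \<bar>k\<bar> then x j else 0)"
    have y: "y \<in> configs n" using x n by (simp add: y_def)
    have "g y = (\<lambda>m. y (m + k))"
    proof (cases "y = (\<lambda>_. 0)")
      case False
      show ?thesis by (rule same[OF y False, of "\<bar>m\<bar> + r + \<bar>k\<bar>"]) (simp add: y_def)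
    qed (simp add: g0)
    moreover have "g x m = g y m" by (rule r(2)[OF x y]) (auto simp: y_def)
    ultimately show "g x m = x (m + k)" using r(1) by (simp add: y_def)
  qed
  then have "g = shift n [^]\<^bsub>shift_Aut n\<^esub> k"
    unfolding shift_int_pow by (intro shift_Aut_eqI[OF g shift_translate_in_Aut]) (simp add: topspace_full_shift)
  then show ?thesis unfolding shift_powers_def by blast
qed

lemma obtain_moved_pattern:
  assumes n: "2 \<le> n" and g: "g \<in> carrier (shift_Aut n)" and g0: "g (\<lambda>_. 0) = (\<lambda>_. 0)"
    and "g \<notin> shift_powers n"
  obtains u a where "u \<in> configs n" "u 0 \<noteq> 0" "\<forall>j<0. u j = 0" "\<forall>j>a. u j = 0"
    "\<forall>k. g u \<noteq> (\<lambda>m. u (m + k))"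
proof -
  obtain y b where y: "y \<in> configs n" "y \<noteq> (\<lambda>_. 0)" "\<And>j. b < \<bar>j\<bar> \<Longrightarrow> y j = 0"
    and gy: "\<And>k. g y \<noteq> (\<lambda>m. y (m + k))"
    using shift_AutI_finite_support[OF n g g0] assms(4) by blast
  obtain t where "y t \<noteq> 0" using y(2) by auto
  then obtain p where p: "y p \<noteq> 0" "\<And>j. j < p \<Longrightarrow> y j = 0"
    by (rule obtain_first_nonzero[of y t "- b"]) (use y(3) in auto)
  show ?thesis
  proof (rule that[of "\<lambda>m. y (m + p)" "\<bar>b\<bar> + \<bar>p\<bar>"])
    show "\<forall>k. g (\<lambda>m. y (m + p)) \<noteq> (\<lambda>m. y (m + k + p))"
    proof (intro allI notI)
      fix k
      assume eq: "g (\<lambda>m. y (m + p)) = (\<lambda>m. y (m + k + p))"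
      have "g y m = y (m + k)" for m
        using fun_cong[OF eq, of "m - p"] unfolding shift_Aut_translate[OF g y(1)] by (simp add: algebra_simps)
      then show False using gy by blast
    qed
  qed (use y p in auto)
qed

section \<open>Means\<close>

text \<open>
Each of the three sets is moved off itself and thus has measure at most 1/2, so its complement has measure at least
1/2; but the three complements are disjoint.
\<close>

lemma not_amenable_of_three_sets:
  assumes am: "amenable H"
    and S: "\<And>i. i < (3::nat) \<Longrightarrow> S i \<subseteq> carrier H"
    and k: "\<And>i. i < 3 \<Longrightarrow> k i \<in> carrier H"
    and disj: "\<And>i s. i < 3 \<Longrightarrow> s \<in> S i \<Longrightarrow> k i \<otimes>\<^bsub>H\<^esub> s \<notin> S i"
    and cover: "\<And>i j. i < j \<Longrightarrow> j < 3 \<Longrightarrow> S i \<union> S j = carrier H"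
  shows False
proof -
  have "group H" using am unfolding amenable_def by blast
  obtain \<mu> :: "'a set \<Rightarrow> real" where
    \<mu>: "\<forall>S. S \<subseteq> carrier H \<longrightarrow> 0 \<le> \<mu> S" "\<mu> (carrier H) = 1"
      "\<forall>S T. S \<subseteq> carrier H \<longrightarrow> T \<subseteq> carrier H \<longrightarrow> S \<inter> T = {} \<longrightarrow> \<mu> (S \<union> T) = \<mu> S + \<mu> T"
      "\<forall>g S. g \<in> carrier H \<longrightarrow> S \<subseteq> carrier H \<longrightarrow> \<mu> (g <#\<^bsub>H\<^esub> S) = \<mu> S"
    using am unfolding amenable_def by (elim conjE exE) (rule that)
  have pos: "0 \<le> \<mu> S" if "S \<subseteq> carrier H" for S using \<mu>(1) that by simp
  have one: "\<mu> (carrier H) = 1" by (rule \<mu>(2))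
  have add: "\<mu> (S \<union> T) = \<mu> S + \<mu> T" if "S \<subseteq> carrier H" "T \<subseteq> carrier H" "S \<inter> T = {}" for S T
    using \<mu>(3) that by simp
  have inv: "\<mu> (g <#\<^bsub>H\<^esub> S) = \<mu> S" if "g \<in> carrier H" "S \<subseteq> carrier H" for g S
    using \<mu>(4) that by simp
  interpret group H by fact
  have compl: "\<mu> (carrier H - A) = 1 - \<mu> A" if "A \<subseteq> carrier H" for A
    using add[of A "carrier H - A"] one that by (simp add: Un_absorb1)
  have le1: "\<mu> A \<le> 1" if "A \<subseteq> carrier H" for A
    using compl[OF that] pos[of "carrier H - A"] by simp
  have big: "1 / 2 \<le> \<mu> (carrier H - S i)" if i: "i < 3" for i
  proof -
    have sub: "k i <#\<^bsub>H\<^esub> S i \<subseteq> carrier H" by (rule l_coset_subset_G[OF S[OF i] k[OF i]])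
    have "S i \<inter> (k i <#\<^bsub>H\<^esub> S i) = {}" using disj[OF i] by (auto simp: l_coset_def)
    then have "\<mu> (S i \<union> (k i <#\<^bsub>H\<^esub> S i)) = \<mu> (S i) + \<mu> (S i)"
      using add[OF S[OF i] sub] inv[OF k[OF i] S[OF i]] by simp
    then have "\<mu> (S i) \<le> 1 / 2" using le1[of "S i \<union> (k i <#\<^bsub>H\<^esub> S i)"] S[OF i] sub by simp
    then show ?thesis using compl[OF S[OF i]] by simp
  qed
  let ?C = "\<lambda>i. carrier H - S i"
  have "?C 0 \<inter> ?C 1 = {}" "(?C 0 \<union> ?C 1) \<inter> ?C 2 = {}"
    using cover[of 0 1] cover[of 0 2] cover[of 1 2] by auto
  then have "\<mu> (?C 0 \<union> ?C 1 \<union> ?C 2) = \<mu> (?C 0) + \<mu> (?C 1) + \<mu> (?C 2)"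
    using add[of "?C 0" "?C 1"] add[of "?C 0 \<union> ?C 1" "?C 2"] by auto
  then show False
    using big[of 0] big[of 1] big[of 2] le1[of "?C 0 \<union> ?C 1 \<union> ?C 2"] by auto
qed

text \<open>
A configuration that is asymptotic to the constant \<open>c\<close> on both sides without being equal to it.
\<close>

definition bump :: "nat \<Rightarrow> int \<Rightarrow> nat"
  where "bump c = (\<lambda>j. if j = 0 then (if c = 0 then 1 else 0) else c)"

definition source_constant :: "nat \<Rightarrow> ((int \<Rightarrow> nat) \<Rightarrow> (int \<Rightarrow> nat)) \<Rightarrow> nat"
  where "source_constant n h = (SOME c. c < n \<and> h (\<lambda>_. c) = (\<lambda>_. 0))"

text \<open>
This transports means from a group of automorphisms to the configurations with a first nonzero coordinate. The orbit map of
a single configuration would not do, since elements that move 0 lead out of this set; therefore the starting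
point is adapted to the constant that \<open>h\<close> sends to 0. The choice is not affected by composing \<open>h\<close> with
an automorphism that fixes 0, whence the equivariance in \<open>base_image_mult\<close> below.
\<close>

definition base_image :: "nat \<Rightarrow> ((int \<Rightarrow> nat) \<Rightarrow> (int \<Rightarrow> nat)) \<Rightarrow> (int \<Rightarrow> nat)"
  where "base_image n h = h (bump (source_constant n h))"

lemma constant_to_zero:
  assumes h: "h \<in> carrier (shift_Aut n)" and n: "0 < n"
  obtains c where "c < n" "h (\<lambda>_. c) = (\<lambda>_. 0)" "(inv\<^bsub>shift_Aut n\<^esub> h) (\<lambda>_. 0) = (\<lambda>_. c)"
proof -
  interpret G: group "shift_Aut n" by (rule group_shift_Aut)
  have z: "(\<lambda>_. 0) \<in> configs n" using n by simp
  define y where "y = (inv\<^bsub>shift_Aut n\<^esub> h) (\<lambda>_. 0)"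
  have y: "y \<in> configs n" unfolding y_def by (rule shift_Aut_apply(1)[OF G.inv_closed[OF h] z])
  have "y (m + k) = y m" for m k
    using fun_cong[OF shift_Aut_translate[OF G.inv_closed[OF h] z, of k], of m] by (simp add: y_def)
  from this[of 0] have yc: "y = (\<lambda>_. y 0)" by auto
  have hy: "h y = (\<lambda>_. 0)" unfolding y_def by (rule shift_Aut_inv_apply(1)[OF h z])
  show ?thesis
  proof (rule that[of "y 0"])
    show "y 0 < n" using y by simp
    show "h (\<lambda>_. y 0) = (\<lambda>_. 0)" by (simp only: yc[symmetric] hy)
    show "(inv\<^bsub>shift_Aut n\<^esub> h) (\<lambda>_. 0) = (\<lambda>_. y 0)"
      by (simp only: yc[symmetric]) (rule y_def[symmetric])
  qed
qed

lemma source_constant: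
  assumes "h \<in> carrier (shift_Aut n)" "0 < n"
  shows "source_constant n h < n" "h (\<lambda>_. source_constant n h) = (\<lambda>_. 0)"
proof -
  obtain c where "c < n" "h (\<lambda>_. c) = (\<lambda>_. 0)" by (rule constant_to_zero[OF assms])
  then have "c < n \<and> h (\<lambda>_. c) = (\<lambda>_. 0)" by blast
  from someI[where P = "\<lambda>c. c < n \<and> h (\<lambda>_. c) = (\<lambda>_. 0)", OF this]
  show "source_constant n h < n" "h (\<lambda>_. source_constant n h) = (\<lambda>_. 0)"
    unfolding source_constant_def by (rule conjunct1, rule conjunct2)
qed

lemma bump_configs: "2 \<le> n \<Longrightarrow> c < n \<Longrightarrow> bump c \<in> configs n"
  by (simp add: bump_def)

lemma base_image_configs:
  assumes "h \<in> carrier (shift_Aut n)" "2 \<le> n"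
  shows "base_image n h \<in> configs n"
proof -
  have "0 < n" using assms(2) by simp
  show ?thesis
    unfolding base_image_def
    by (rule shift_Aut_apply(1)[OF assms(1) bump_configs[OF assms(2) source_constant(1)[OF assms(1) \<open>0 < n\<close>]]])
qed

lemma base_image_first_nonzero:
  assumes h: "h \<in> carrier (shift_Aut n)" and n: "2 \<le> n"
  obtains f where "base_image n h f \<noteq> 0" "\<forall>j<f. base_image n h j = 0"
proof -
  let ?c = "source_constant n h"
  have c: "?c < n" "h (\<lambda>_. ?c) = (\<lambda>_. 0)" using source_constant[OF h] n by auto
  have cc: "(\<lambda>_. ?c) \<in> configs n" using c(1) by simp
  have b: "bump ?c \<in> configs n" by (rule bump_configs[OF n c(1)])
  obtain r where "has_radius n h r" by (rule shift_Aut_local[OF h])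
  note r = has_radiusD[OF this]
  have left: "base_image n h j = 0" if "j < - r" for j
  proof -
    have "base_image n h j = h (\<lambda>_. ?c) j"
      unfolding base_image_def by (rule r(2)[OF b cc]) (use that in \<open>simp add: bump_def\<close>)
    then show ?thesis by (simp add: c(2))
  qed
  have "base_image n h \<noteq> (\<lambda>_. 0)"
  proof
    assume "base_image n h = (\<lambda>_. 0)"
    then have "bump ?c = (\<lambda>_. ?c)"
      using inj_onD[OF shift_Aut_apply(2)[OF h] _ b cc] c(2) by (simp add: base_image_def)
    from fun_cong[OF this, of 0] show False by (simp add: bump_def split: if_splits)
  qed
  then obtain t where t: "base_image n h t \<noteq> 0" by auto
  show ?thesis by (rule obtain_first_nonzero[of "base_image n h" t "- r"]) (use t left that in blast)+
qed

lemma base_image_mult: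
  assumes k: "k \<in> carrier (shift_Aut n)" and k0: "k (\<lambda>_. 0) = (\<lambda>_. 0)"
    and h: "h \<in> carrier (shift_Aut n)" and n: "2 \<le> n"
  shows "base_image n (k \<otimes>\<^bsub>shift_Aut n\<^esub> h) = k (base_image n h)"
proof -
  have z: "(\<lambda>_. 0) \<in> configs n" using n by simp
  have "(k \<otimes>\<^bsub>shift_Aut n\<^esub> h) (\<lambda>_. c) = (\<lambda>_. 0) \<longleftrightarrow> h (\<lambda>_. c) = (\<lambda>_. 0)" if "c < n" for c
  proof -
    have cc: "(\<lambda>_. c) \<in> configs n" using that by simp
    show ?thesis
      using inj_onD[OF shift_Aut_apply(2)[OF k] _ shift_Aut_apply(1)[OF h cc] z] k0
      by (auto simp: shift_Aut_mult_apply[OF k h cc])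
  qed
  then have "source_constant n (k \<otimes>\<^bsub>shift_Aut n\<^esub> h) = source_constant n h"
    unfolding source_constant_def by (metis (no_types, lifting))
  moreover have "bump (source_constant n h) \<in> configs n"
    by (rule bump_configs[OF n source_constant(1)[OF h]]) (use n in simp)
  ultimately show ?thesis by (simp add: base_image_def shift_Aut_mult_apply[OF k h])
qed

section \<open>Normal amenable subgroups\<close>

text \<open>
Apply \<open>not_amenable_of_three_sets\<close> to the preimages \<open>S i\<close> of one cone under the toggles with block lengths
\<open>K\<close>, \<open>K + 1\<close>, \<open>K + 2\<close>. As \<open>g\<close> moves the cone off itself, the conjugate of \<open>g\<close> by a toggle moves
the corresponding \<open>S i\<close> off itself, and it lies in \<open>N\<close> by normality.
\<close>

lemma normal_amenable_fixing_zero: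
  assumes n: "2 \<le> n" and N: "normal N (shift_Aut n)" and am: "amenable ((shift_Aut n)\<lparr>carrier := N\<rparr>)"
    and gN: "g \<in> N" and g0: "g (\<lambda>_. 0) = (\<lambda>_. 0)"
  shows "g \<in> shift_powers n"
proof (rule ccontr)
  assume "g \<notin> shift_powers n"
  interpret N: normal N "shift_Aut n" by fact
  have NG: "h \<in> carrier (shift_Aut n)" if "h \<in> N" for h using N.subset that by blast
  have g: "g \<in> carrier (shift_Aut n)" using NG gN .
  obtain u a where u: "u \<in> configs n" "u 0 \<noteq> 0" "\<forall>j<0. u j = 0" "\<forall>j>a. u j = 0"
    and gu: "\<forall>k. g u \<noteq> (\<lambda>m. u (m + k))"
    by (rule obtain_moved_pattern[OF n g g0 \<open>g \<notin> shift_powers n\<close>])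
  obtain K0 where K0: "\<forall>K\<ge>K0. \<forall>x\<in>configs n. x \<in> cone u K \<longrightarrow> g x \<notin> cone u K"
    by (rule shift_Aut_moves_cone[OF g g0 u gu])
  define K where "K = max 1 (max K0 (a + 1))"
  have K: "0 < K" "K0 \<le> K" "a < K" by (auto simp: K_def)
  have pat: "toggle_pattern u K (K + int i)" for i
    by unfold_locales (use u(2) K(1) in auto)
  define \<tau> where "\<tau> i = toggle u K (K + int i)" for i
  define T where "T i = restrict (\<tau> i) (configs n)" for i
  have T: "T i \<in> carrier (shift_Aut n)" for i
    unfolding T_def \<tau>_def by (rule toggle_pattern.toggle_in_shift_Aut[OF pat u(1)])
  have Tx: "T i x = \<tau> i x" if "x \<in> configs n" for i x using that by (simp add: T_def)
  have TT: "T i (T i x) = x" if "x \<in> configs n" for i x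
    using Tx shift_Aut_apply(1)[OF T that] toggle_pattern.toggle_toggle[OF pat] that
    by (simp add: \<tau>_def)
  have invT: "inv\<^bsub>shift_Aut n\<^esub> (T i) = T i" for i
  proof (rule N.inv_equality[OF _ T T])
    show "T i \<otimes>\<^bsub>shift_Aut n\<^esub> T i = \<one>\<^bsub>shift_Aut n\<^esub>"
      by (rule shift_Aut_eqI[OF N.m_closed[OF T T] N.one_closed])
        (simp add: shift_Aut_mult_apply[OF T T] TT shift_Aut_one_apply)
  qed
  have T0: "T i (\<lambda>_. 0) = (\<lambda>_. 0)" for i
  proof -
    have "\<tau> i (\<lambda>_. 0) = (\<lambda>_. 0)"
      unfolding \<tau>_def by (rule ext, rule toggle_pattern.toggle_off[OF pat]) (simp add: markers_def)
    then show ?thesis using n by (simp add: Tx)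
  qed
  define k where "k i = T i \<otimes>\<^bsub>shift_Aut n\<^esub> g \<otimes>\<^bsub>shift_Aut n\<^esub> inv\<^bsub>shift_Aut n\<^esub> (T i)" for i
  have kN: "k i \<in> N" for i unfolding k_def by (rule N.inv_op_closed2[OF T gN])
  have kx: "k i x = T i (g (T i x))" if "x \<in> configs n" for i x
    unfolding k_def invT
    by (simp add: shift_Aut_mult_apply[OF N.m_closed[OF T g] T that]
        shift_Aut_mult_apply[OF T g shift_Aut_apply(1)[OF T that]])
  have z: "(\<lambda>_. 0) \<in> configs n" using n by simp
  have k0: "k i (\<lambda>_. 0) = (\<lambda>_. 0)" for i using kx[OF z] by (simp add: T0 g0)
  define S where "S i = {h \<in> N. T i (base_image n h) \<in> cone u K}" for i
  \<comment> \<open>What a toggle does not send to the cone lies in the exact cone of its block length.\<close>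
  have miss: "base_image n h \<in> exact_cone u (K + int i)" if h: "h \<in> N" "h \<notin> S i" for h i
  proof (rule ccontr)
    assume "base_image n h \<notin> exact_cone u (K + int i)"
    moreover obtain f where "base_image n h f \<noteq> 0" "\<forall>j<f. base_image n h j = 0"
      by (rule base_image_first_nonzero[OF NG[OF h(1)] n])
    ultimately have "\<tau> i (base_image n h) \<in> cone u K"
      unfolding \<tau>_def using u(3) by (intro toggle_pattern.toggle_maps_into_cone[OF pat]) auto
    then show False using h Tx[OF base_image_configs[OF NG[OF h(1)] n]] by (simp add: S_def)
  qed
  show False
  proof (rule not_amenable_of_three_sets[OF am, of S k])
    fix i j :: nat assume ij: "i < j"
    have "exact_cone u (K + int i) \<inter> exact_cone u (K + int j) = {}"
      by (rule exact_cones_disjoint) (use u K ij in auto)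
    then show "S i \<union> S j = carrier ((shift_Aut n)\<lparr>carrier := N\<rparr>)"
      using miss by (auto simp: S_def)
  next
    fix i :: nat and s assume s: "s \<in> S i"
    then have sN: "s \<in> N" by (simp add: S_def)
    let ?x = "base_image n s"
    have x: "?x \<in> configs n" by (rule base_image_configs[OF NG[OF sN] n])
    have "base_image n (k i \<otimes>\<^bsub>shift_Aut n\<^esub> s) = k i ?x"
      by (rule base_image_mult[OF NG[OF kN] k0 NG[OF sN] n])
    moreover have "T i (k i ?x) = g (T i ?x)"
      unfolding kx[OF x] by (intro TT shift_Aut_apply(1)[OF g] shift_Aut_apply(1)[OF T] x)
    moreover have "g (T i ?x) \<notin> cone u K"
      using s by (intro K0[rule_format] K shift_Aut_apply(1)[OF T x]) (simp add: S_def)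
    ultimately show "k i \<otimes>\<^bsub>(shift_Aut n)\<lparr>carrier := N\<rparr>\<^esub> s \<notin> S i"
      by (simp add: S_def)
  qed (use kN in \<open>auto simp: S_def\<close>)
qed

text \<open>
Let \<open>c \<noteq> 0\<close> be the constant that \<open>g\<close> sends to 0, and let \<open>h\<close> be a toggle. Toggles fix all constants, hence the
commutator \<open>g h g\<^sup>-\<^sup>1 h\<^sup>-\<^sup>1\<close> fixes 0. For \<open>x = ...000 11 000...\<close>, the configuration
\<open>g\<^sup>-\<^sup>1 x\<close> is asymptotic to \<open>c\<close> on both sides and has no long run of zeros. If the block length of \<open>h\<close> is
large, then \<open>h\<close> fixes it, so the commutator maps \<open>h x\<close> to \<open>x\<close>. But \<open>h x\<close> is not a translate of \<open>x\<close>,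
because \<open>h\<close> inserts a distant third 1 in front of \<open>x\<close>.
\<close>

lemma commutator_fixing_zero:
  assumes n: "2 \<le> n" and N: "normal N (shift_Aut n)"
    and gN: "g \<in> N" and g0: "g (\<lambda>_. 0) \<noteq> (\<lambda>_. 0)"
  obtains g' where "g' \<in> N" "g' (\<lambda>_. 0) = (\<lambda>_. 0)" "g' \<notin> shift_powers n"
proof -
  interpret N: normal N "shift_Aut n" by fact
  have g: "g \<in> carrier (shift_Aut n)" using N.subset gN by blast
  let ?i = "inv\<^bsub>shift_Aut n\<^esub> g"
  have ig: "?i \<in> carrier (shift_Aut n)" by (rule N.inv_closed[OF g])
  obtain c where c: "c < n" "g (\<lambda>_. c) = (\<lambda>_. 0)" "?i (\<lambda>_. 0) = (\<lambda>_. c)"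
    by (rule constant_to_zero[OF g]) (use n in simp)
  have "c \<noteq> 0" using g0 c(2) by auto
  have z: "(\<lambda>_. 0) \<in> configs n" and cc: "(\<lambda>_. c) \<in> configs n" using n c(1) by auto
  obtain r where "has_radius n ?i r" by (rule shift_Aut_local[OF ig])
  note r = has_radiusD[OF this]
  define x :: "int \<Rightarrow> nat" where "x = (\<lambda>j. if j = 0 \<or> j = 1 then 1 else 0)"
  have x: "x \<in> configs n" using n by (simp add: x_def)
  have ix: "?i x j = c" if "j < - r \<or> 1 + r < j" for j
  proof -
    have "?i x j = ?i (\<lambda>_. 0) j" by (rule r(2)[OF x z]) (use that in \<open>auto simp: x_def\<close>)
    then show ?thesis by (simp add: c(3))
  qed
  define u :: "int \<Rightarrow> nat" where "u = (\<lambda>j. if j = 0 then 1 else 0)"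
  \<comment> \<open>The image \<open>?i x\<close> differs from \<open>c\<close> only on \<open>[-r, r + 1]\<close>, which has \<open>2 * r + 2\<close> points.\<close>
  define K where "K = 2 * r + 3"
  have u: "u \<in> configs n" using n by (simp add: u_def)
  interpret P: toggle_pattern u K K by unfold_locales (use r(1) in \<open>auto simp: u_def K_def\<close>)
  define h where "h = restrict (toggle u K K) (configs n)"
  have h: "h \<in> carrier (shift_Aut n)" unfolding h_def by (rule P.toggle_in_shift_Aut[OF u])
  have hx: "h y = toggle u K K y" if "y \<in> configs n" for y using that by (simp add: h_def)
  have hh: "h (h y) = y" if "y \<in> configs n" for y
    using hx[OF that] hx[OF shift_Aut_apply(1)[OF h that]] by (simp add: P.toggle_toggle)
  have invh: "inv\<^bsub>shift_Aut n\<^esub> h = h"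
  proof (rule N.inv_equality[OF _ h h])
    show "h \<otimes>\<^bsub>shift_Aut n\<^esub> h = \<one>\<^bsub>shift_Aut n\<^esub>"
      by (rule shift_Aut_eqI[OF N.m_closed[OF h h] N.one_closed])
        (simp add: shift_Aut_mult_apply[OF h h] hh shift_Aut_one_apply)
  qed
  have hfix: "h y = y" if "y \<in> configs n" "markers u K K y = {}" for y
    unfolding hx[OF that(1)] by (rule ext, rule P.toggle_off) (simp add: that(2))
  have h0: "h (\<lambda>_. 0) = (\<lambda>_. 0)" by (rule hfix[OF z]) (simp add: markers_def)
  have hc: "h (\<lambda>_. c) = (\<lambda>_. c)"
  proof (rule hfix[OF cc])
    have "\<exists>j\<in>{f - 2 * K..<f - K}. True" for f using P.K_pos by (intro bexI[of _ "f - 2 * K"]) auto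
    then show "markers u K K (\<lambda>_. c) = {}" using \<open>c \<noteq> 0\<close> by (fastforce simp: markers_def)
  qed
  have hix: "h (?i x) = ?i x"
  proof (rule hfix[OF shift_Aut_apply(1)[OF ig x]])
    have "f \<notin> markers u K K (?i x)" for f
    proof
      assume f: "f \<in> markers u K K (?i x)"
      have "?i x (f - 2 * K) = 0" "?i x (f - K - 1) = 0"
        using f P.K_pos by (auto simp: markers_def)
      then show False using ix[of "f - 2 * K"] ix[of "f - K - 1"] \<open>c \<noteq> 0\<close> by (force simp: K_def)
    qed
    then show "markers u K K (?i x) = {}" by blast
  qed
  define g' where "g' = g \<otimes>\<^bsub>shift_Aut n\<^esub> (h \<otimes>\<^bsub>shift_Aut n\<^esub> ?i \<otimes>\<^bsub>shift_Aut n\<^esub> inv\<^bsub>shift_Aut n\<^esub> h)"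
  have g'N: "g' \<in> N"
    unfolding g'_def by (intro N.subgroup_axioms[THEN subgroup.m_closed] gN N.inv_op_closed2[OF h] N.subgroup_axioms[THEN subgroup.m_inv_closed])
  have g'x: "g' y = g (h (?i (h y)))" if "y \<in> configs n" for y
    unfolding g'_def invh
    by (simp add: shift_Aut_mult_apply[OF g N.m_closed[OF N.m_closed[OF h ig] h] that]
        shift_Aut_mult_apply[OF N.m_closed[OF h ig] h that]
        shift_Aut_mult_apply[OF h ig shift_Aut_apply(1)[OF h that]])
  show ?thesis
  proof (rule that[OF g'N])
    show "g' (\<lambda>_. 0) = (\<lambda>_. 0)" by (simp add: g'x[OF z] h0 c hc)
    show "g' \<notin> shift_powers n"
    proof
      assume "g' \<in> shift_powers n"
      then obtain k where k: "\<And>y. y \<in> configs n \<Longrightarrow> g' y = (\<lambda>m. y (m + k))"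
        unfolding shift_powers_def shift_int_pow by (auto simp: topspace_full_shift)
      have "g' (h x) = x"
        using g'x[OF shift_Aut_apply(1)[OF h x]] by (simp add: hh[OF x] hix shift_Aut_inv_apply(1)[OF g x])
      then have xk: "h x (m + k) = x m" for m using k[OF shift_Aut_apply(1)[OF h x]] by (metis (lifting))
      have K3: "3 \<le> K" using r(1) by (simp add: K_def)
      have left: "h x j = u (j + K)" if "j < 0" for j
      proof -
        have "toggle u K K x j = u (j - (0 - K))"
        proof (rule P.toggle_inserts_pattern)
          show "\<not> (\<forall>j\<in>{0..<0 + K}. x j = u (j - 0))"
            using K3 by (auto simp: x_def u_def intro!: bexI[of _ 1])
        qed (use that in \<open>auto simp: x_def u_def\<close>)
        then show ?thesis by (simp add: hx[OF x])
      qed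
      have "x (- K - k) \<noteq> 0" using xk[of "- K - k"] left[of "- K"] K3 by (simp add: u_def)
      then have "k \<le> - K" by (auto simp: x_def split: if_splits)
      then have "u (k + K) \<noteq> 0" "u (1 + k + K) \<noteq> 0"
        using xk[of 0] xk[of 1] left[of k] left[of "1 + k"] K3 by (auto simp: x_def)
      then show False by (auto simp: u_def split: if_splits)
    qed
  qed
qed

theorem theorem1p1:
  fixes n :: nat and N :: "((int \<Rightarrow> nat) \<Rightarrow> (int \<Rightarrow> nat)) set"
  assumes "n \<ge> 2"
    and "normal N (shift_Aut n)"
    and "amenable ((shift_Aut n)\<lparr>carrier := N\<rparr>)"
  shows "N \<subseteq> shift_powers n"
proof
  fix g assume "g \<in> N"
  then have "g (\<lambda>_. 0) = (\<lambda>_. 0)"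
    using commutator_fixing_zero[OF assms(1,2) \<open>g \<in> N\<close>] normal_amenable_fixing_zero[OF assms] by blast
  then show "g \<in> shift_powers n" using normal_amenable_fixing_zero[OF assms \<open>g \<in> N\<close>] by blast
qed

end
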